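(* Let $X$ be a geodesic metric space equipped with a bounded geodesic combing. Then the set of all geodesic segments in $X$ is a navigable path system.
   Context: A geodesic combing assigns to every ordered pair $(x,y)\in X\times X$ a geodesic $q_{xy}$ from $x$ to $y$ (parametrized by arc length on $[0,d(x,y)]$ and extended to $\mathbb R$ by constant maps). It is bounded if there is $\kappa_0\ge0$ with $d(q_{xy_1}(t),q_{xy_2}(t))\le\kappa_0d(y_1,y_2)+\kappa_0$ for all $t\in\mathbb R$ and $x,y_1,y_2\in X$. Let $\mathcal P$ be the set of all geodesic segments of $X$ (including trivial ones). An $(n,\mathcal P)$-polygonal line is a concatenation of at most $n$ geodesic segments; $\alpha^\pm$ denote endpoints and $\|p\|$ length. $\mathcal P$ is navigable if there are $C\ge1$ and an integer $k\ge1$ such that for every $R\ge C$, $m\in X$, $n$, and $(n,\mathcal P)$-polygonal line $\alpha$ with $d(\alpha,m)\ge R$ and $d(\alpha^\pm,m)\le2R$, there is a $(kn,\mathcal P)$-polygonal line $p$ with the same endpoints as $\alpha$, $\|p\|\le CnR$, avoiding the closed ball $B(m,R/C)$. *)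

theory Defs
  imports "HOL-Analysis.Analysis"
begin

section \<open>Geodesics and geodesic combings\<close>

text \<open>Geodesics are parametrised by arc length on \<open>[0, d(x,y)]\<close>; nothing is required of \<open>q\<close>
  outside this interval.\<close>

definition geodesic_from_to :: "'a::metric_space \<Rightarrow> 'a \<Rightarrow> (real \<Rightarrow> 'a) \<Rightarrow> bool" where
  "geodesic_from_to x y q \<longleftrightarrow>
     q 0 = x \<and> q (dist x y) = y \<and>
     (\<forall>s\<in>{0..dist x y}. \<forall>t\<in>{0..dist x y}. dist (q s) (q t) = \<bar>s - t\<bar>)"

definition geodesic_metric_space :: "'a::metric_space itself \<Rightarrow> bool" where
  "geodesic_metric_space _ \<longleftrightarrow> (\<forall>x y :: 'a. \<exists>q. geodesic_from_to x y q)"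

definition geodesic_combing :: "('a::metric_space \<Rightarrow> 'a \<Rightarrow> real \<Rightarrow> 'a) \<Rightarrow> bool" where
  "geodesic_combing q \<longleftrightarrow>
     (\<forall>x y. geodesic_from_to x y (q x y) \<and>
        (\<forall>t\<le>0. q x y t = x) \<and> (\<forall>t\<ge>dist x y. q x y t = y))"

definition bounded_combing :: "('a::metric_space \<Rightarrow> 'a \<Rightarrow> real \<Rightarrow> 'a) \<Rightarrow> bool" where
  "bounded_combing q \<longleftrightarrow>
     (\<exists>\<kappa>\<ge>0. \<forall>t x y\<^sub>1 y\<^sub>2. dist (q x y\<^sub>1 t) (q x y\<^sub>2 t) \<le> \<kappa> * dist y\<^sub>1 y\<^sub>2 + \<kappa>)"

section \<open>Paths and their length\<close>

text \<open>Paths are the library's paths, that is, maps on \<open>[0,1]\<close>. A geodesic segment therefore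
  appears as the affine reparametrisation of an arc-length geodesic; the trivial ones are the
  constant paths.\<close>

definition geodesic_segments :: "(real \<Rightarrow> 'a::metric_space) set" where
  "geodesic_segments =
     {g. \<exists>x y q. geodesic_from_to x y q \<and> (\<forall>s\<in>{0..1}. g s = q (dist x y * s))}"

definition path_length :: "(real \<Rightarrow> 'a::metric_space) \<Rightarrow> ennreal" where
  "path_length g =
     (SUP ts \<in> {ts. sorted ts \<and> set ts \<subseteq> {0..1}}.
        \<Sum>i<length ts - 1. ennreal (dist (g (ts ! i)) (g (ts ! Suc i))))"

text \<open>The library's \<^const>\<open>subpath\<close> is only available in real normed vector spaces, so the
  subpath from \<open>u\<close> to \<open>v\<close> is written out. The length estimate, which by closure under subpaths
  applies to all subpaths as well, says that the members of \<open>P\<close> are uniform quasi-geodesics.\<close>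

definition path_system :: "(real \<Rightarrow> 'a::metric_space) set \<Rightarrow> bool" where
  "path_system P \<longleftrightarrow>
     (\<forall>g\<in>P. path g) \<and>
     (\<exists>\<mu>\<ge>1. \<exists>c\<ge>0. \<forall>g\<in>P. path_length g \<le> ennreal (\<mu> * dist (pathstart g) (pathfinish g) + c)) \<and>
     (\<forall>g\<in>P. \<forall>u v. 0 \<le> u \<and> u \<le> v \<and> v \<le> 1 \<longrightarrow> (\<lambda>s. g ((v - u) * s + u)) \<in> P) \<and>
     (\<forall>x y. \<exists>g\<in>P. pathstart g = x \<and> pathfinish g = y)"

section \<open>Navigability\<close>

text \<open>\<open>polygonal_line P n p\<close>: \<open>p\<close> is a concatenation of at least one and at most \<open>n\<close> elements of
  \<open>P\<close> (``at most'' because the first rule accepts every \<open>n \<ge> 1\<close>).\<close>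

inductive polygonal_line ::
  "(real \<Rightarrow> 'a::metric_space) set \<Rightarrow> nat \<Rightarrow> (real \<Rightarrow> 'a) \<Rightarrow> bool" for P where
  single: "g \<in> P \<Longrightarrow> n \<ge> 1 \<Longrightarrow> polygonal_line P n g"
| join: "polygonal_line P n p \<Longrightarrow> g \<in> P \<Longrightarrow> pathfinish p = pathstart g \<Longrightarrow>
    polygonal_line P (Suc n) (p +++ g)"

definition navigable :: "(real \<Rightarrow> 'a::metric_space) set \<Rightarrow> bool" where
  "navigable P \<longleftrightarrow>
     (\<exists>C\<ge>1. \<exists>k\<ge>1. \<forall>R\<ge>C. \<forall>m n \<alpha>.
        polygonal_line P n \<alpha> \<and>
        infdist m (path_image \<alpha>) \<ge> R \<and>
        dist (pathstart \<alpha>) m \<le> 2 * R \<and> dist (pathfinish \<alpha>) m \<le> 2 * R \<longrightarrow>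
        (\<exists>p. polygonal_line P (k * n) p \<and>
             pathstart p = pathstart \<alpha> \<and> pathfinish p = pathfinish \<alpha> \<and>
             path_length p \<le> ennreal (C * real n * R) \<and>
             path_image p \<inter> cball m (R / C) = {}))"

end

theory Submission
  imports Defs
begin

text \<open>Fix \<open>m\<close> and put \<open>\<epsilon> = R / 4\<close>. The shadow of \<open>v\<close> is the set of points \<open>x\<close> at distance \<open>O(\<epsilon>)\<close>
  from \<open>m\<close> that are closer to \<open>v\<close> than \<open>m\<close> is, by at least \<open>\<epsilon>\<close>. Boundedness of the combing implies that
  any two points of one shadow are joined, away from \<open>m\<close>, by a bounded number of geodesics of
  length \<open>O(\<epsilon>)\<close>, however far \<open>v\<close> is. The shadows of \<open>v\<close> and \<open>w\<close> are joined in the same way if the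
  combing line from \<open>v\<close> to \<open>w\<close> misses the \<open>\<epsilon>\<close>-ball around \<open>m\<close>. For an arbitrary geodesic from \<open>a\<close> to
  \<open>b\<close> outside the \<open>R\<close>-ball, some point \<open>c\<close> on it is such that, up to an error of 1 in \<open>c\<close>, the combing
  lines from \<open>a\<close> to \<open>c\<close> and from \<open>c\<close> to \<open>b\<close> both miss the \<open>\<epsilon>\<close>-ball. So the shadows of the vertices of a
  polygonal line can be joined successively, and each endpoint of the line lies in its own shadow.\<close>

section \<open>Geodesics\<close>

lemma geodesic_dist:
  assumes "geodesic_from_to x y h" "s \<in> {0..dist x y}" "t \<in> {0..dist x y}"
  shows "dist (h s) (h t) = \<bar>s - t\<bar>"
  using assms unfolding geodesic_from_to_def by blast

lemma geodesic_start: "geodesic_from_to x y h \<Longrightarrow> h 0 = x"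
  and geodesic_end: "geodesic_from_to x y h \<Longrightarrow> h (dist x y) = y"
  unfolding geodesic_from_to_def by blast+

lemma geodesic_dist_start:
  assumes "geodesic_from_to x y h" "t \<in> {0..dist x y}"
  shows "dist x (h t) = t"
  using geodesic_dist[OF assms(1), of 0 t] assms by (auto simp: geodesic_start)

lemma geodesic_dist_end:
  assumes "geodesic_from_to x y h" "t \<in> {0..dist x y}"
  shows "dist (h t) y = dist x y - t"
  using geodesic_dist[OF assms(1), of t "dist x y"] assms by (auto simp: geodesic_end)

lemma geodesic_sub:
  assumes "geodesic_from_to x y h" "0 \<le> s" "s \<le> t" "t \<le> dist x y"
  shows "geodesic_from_to (h s) (h t) (\<lambda>u. h (s + u))"
proof -
  have "dist (h s) (h t) = t - s"
    using geodesic_dist[OF assms(1), of s t] assms by auto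
  then show ?thesis
    using assms geodesic_dist[OF assms(1)] unfolding geodesic_from_to_def by auto
qed

lemma geodesic_rev:
  assumes "geodesic_from_to x y h"
  shows "geodesic_from_to y x (\<lambda>u. h (dist x y - u))"
  using assms geodesic_dist[OF assms] unfolding geodesic_from_to_def
  by (auto simp: dist_commute)

lemma geodesic_refl: "geodesic_from_to x x (\<lambda>_. x)"
  unfolding geodesic_from_to_def by auto

text \<open>Combing lines need not vary continuously with their endpoints, so a search in unit steps
  replaces the intermediate value theorem; the error 1 is later absorbed by
  \<open>\<epsilon>\<close>.\<close>

lemma discrete_crossing:
  fixes L :: real
  assumes "P 0" "\<not> P L" "0 \<le> L"
  obtains s t where "s \<in> {0..L}" "t \<in> {0..L}" "\<bar>s - t\<bar> \<le> 1" "P s" "\<not> P t"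
proof (rule ccontr)
  assume *: "\<not> thesis"
  have "P (min (real i) L)" for i
  proof (induction i)
    case 0
    then show ?case using assms by simp
  next
    case (Suc i)
    have "\<bar>min (real i) L - min (real (Suc i)) L\<bar> \<le> 1" by auto
    then show ?case
      using * Suc assms(3) that[of "min (real i) L" "min (real (Suc i)) L"]
      by (auto simp del: of_nat_Suc)
  qed
  moreover obtain i where "L \<le> real i" using real_arch_simple by blast
  ultimately show False using assms(2) by (metis min.absorb2)
qed

section \<open>Chains of geodesics avoiding a ball\<close>

text \<open>Powers of this relation count geodesics, so a single exponent controls both the number
  of sides and the total length.\<close>

definition link :: "'a::metric_space \<Rightarrow> real \<Rightarrow> real \<Rightarrow> 'a \<Rightarrow> 'a \<Rightarrow> bool" where
  "link m r l x y \<longleftrightarrow> dist x y \<le> l \<and>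
     (\<exists>h. geodesic_from_to x y h \<and> (\<forall>t\<in>{0..dist x y}. r < dist (h t) m))"

lemma link_sym:
  assumes "link m r l x y"
  shows "link m r l y x"
proof -
  obtain h where h: "geodesic_from_to x y h" "\<forall>t\<in>{0..dist x y}. r < dist (h t) m"
    using assms unfolding link_def by blast
  show ?thesis
    unfolding link_def using assms geodesic_rev[OF h(1)] h(2)
    by (intro conjI exI[of _ "\<lambda>u. h (dist x y - u)"])
      (auto simp: link_def dist_commute)
qed

lemma relpowp_sym:
  assumes "\<And>x y. P x y \<Longrightarrow> P y x"
  shows "(P ^^ n) x y \<Longrightarrow> (P ^^ n) y x"
proof (induction n arbitrary: y)
  case (Suc n)
  then obtain z where "(P ^^ n) x z" "P z y" by auto
  then show ?case using Suc.IH assms by (metis relpowp_Suc_I2)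
qed auto

lemma relpowp_trans:
  assumes "(P ^^ i) x y" "(P ^^ j) y z"
  shows "(P ^^ (i + j)) x z"
  using assms by (auto simp: relpowp_add)

lemma relpowp_chain:
  assumes "\<And>i. i < n \<Longrightarrow> P (f i) (f (Suc i))"
  shows "(P ^^ n) (f 0) (f n)"
  using assms by (induction n) (auto intro: relcomppI)

lemma link_sub:
  assumes h: "geodesic_from_to x y h" and "s \<in> {0..dist x y}" "t \<in> {0..dist x y}" "\<bar>s - t\<bar> \<le> l"
    and "\<And>u. u \<in> {0..dist x y} \<Longrightarrow> min s t \<le> u \<Longrightarrow> u \<le> max s t \<Longrightarrow> r < dist (h u) m"
  shows "link m r l (h s) (h t)"
proof -
  have le: "link m r l (h s) (h t)"
    if "s \<le> t" "s \<in> {0..dist x y}" "t \<in> {0..dist x y}" "\<bar>s - t\<bar> \<le> l"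
      "\<And>u. u \<in> {0..dist x y} \<Longrightarrow> s \<le> u \<Longrightarrow> u \<le> t \<Longrightarrow> r < dist (h u) m" for s t
    unfolding link_def using that geodesic_sub[OF h, of s t] geodesic_dist[OF h, of s t]
    by (intro conjI exI[of _ "\<lambda>u. h (s + u)"]) auto
  show ?thesis
  proof (cases "s \<le> t")
    case True
    then show ?thesis using le assms by auto
  next
    case False
    then have "link m r l (h t) (h s)" using assms by (intro le) auto
    then show ?thesis by (rule link_sym)
  qed
qed

section \<open>Shadows near the centre of the ball\<close>

text \<open>\<open>eps_ge\<close> makes the additive error of the combing small against
  \<open>\<epsilon>\<close>. The step count \<open>N\<close> is bounded below in terms of
  \<open>\<kappa>\<close> only, which keeps all chain lengths uniform in
  \<open>\<epsilon>\<close>.\<close>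

locale combed_ball =
  fixes q :: "'a::metric_space \<Rightarrow> 'a \<Rightarrow> real \<Rightarrow> 'a" and \<kappa> :: real and m :: 'a and \<epsilon> :: real
    and N :: nat
  assumes combing: "geodesic_combing q"
    and bounded: "dist (q x y t) (q x z t) \<le> \<kappa> * dist y z + \<kappa>"
    and kappa_ge: "1 \<le> \<kappa>"
    and eps_ge: "8 * \<kappa> \<le> \<epsilon>"
    and N_ge: "32 * \<kappa> \<le> real N"
begin

lemma geo: "geodesic_from_to x y (q x y)"
  using combing unfolding geodesic_combing_def by blast

lemma comb_clamp: "q x y t = q x y (max 0 (min t (dist x y)))"
proof -
  have "q x y s = x" if "s \<le> 0" for s
    using combing that unfolding geodesic_combing_def by blast
  moreover have "q x y s = y" if "s \<ge> dist x y" for s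
    using combing that unfolding geodesic_combing_def by blast
  ultimately show ?thesis by (auto simp: max_def min_def)
qed

lemma comb_dist_start_le: "0 \<le> t \<Longrightarrow> dist x (q x y t) \<le> t"
  using geodesic_dist_start[OF geo, of "max 0 (min t (dist x y))" x y] comb_clamp[of x y t] by auto

text \<open>For \<open>\<epsilon> = R / 4\<close> the bound \<open>8 * \<epsilon>\<close> is the
  bound \<open>2 * R\<close> on the endpoints of the given line. It also places two points of a
  shadow within \<open>16 * \<epsilon>\<close>, the link length in \<open>reach\<close>.\<close>

definition shadow :: "'a \<Rightarrow> 'a set" where
  "shadow v = {x. dist x m \<le> 8 * \<epsilon> \<and> dist v x \<le> dist v m - \<epsilon>}"

abbreviation reach :: "nat \<Rightarrow> 'a \<Rightarrow> 'a \<Rightarrow> bool" where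
  "reach n \<equiv> link m (\<epsilon> / 2) (16 * \<epsilon>) ^^ n"

abbreviation misses :: "'a \<Rightarrow> 'a \<Rightarrow> bool" where
  "misses v w \<equiv> (\<forall>t. \<epsilon> < dist (q v w t) m)"

lemma reach_sym: "reach n x y \<Longrightarrow> reach n y x"
  by (rule relpowp_sym) (rule link_sym)

lemma eps_pos: "0 < \<epsilon>" "8 \<le> \<epsilon>" "\<kappa> \<le> \<epsilon> / 8"
  using kappa_ge eps_ge by auto

lemma link_near:
  assumes "\<epsilon> \<le> dist x m" "dist x y < \<epsilon> / 2"
  shows "link m (\<epsilon> / 2) (16 * \<epsilon>) x y"
  unfolding link_def
proof (intro conjI exI[of _ "q x y"] geo ballI)
  show "dist x y \<le> 16 * \<epsilon>" using assms eps_pos by auto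
  fix t assume t: "t \<in> {0..dist x y}"
  then have "dist x (q x y t) = t" by (rule geodesic_dist_start[OF geo])
  then show "\<epsilon> / 2 < dist (q x y t) m"
    using t assms dist_triangle[of x m "q x y t"] by auto
qed

text \<open>The endpoint of a combing line from \<open>v\<close> slides from \<open>x\<close> to \<open>m\<close>. Its point at time
  \<open>dist v x\<close> moves by short jumps and stays within \<open>dist v m - \<epsilon>\<close> of \<open>v\<close>, hence away from \<open>m\<close>.\<close>

lemma shadow_reach_comb:
  assumes "x \<in> shadow v"
  shows "reach N x (q v m (dist v x))"
proof -
  have N: "0 < real N" using N_ge kappa_ge by linarith
  define c where "c i = q x m (real i * (dist x m / real N))" for i
  define z where "z i = q v (c i) (dist v x)" for i
  have c: "dist (c i) (c (Suc i)) \<le> 8 * \<epsilon> / real N" if "i < N" for i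
  proof -
    have *: "real j * (dist x m / real N) \<in> {0..dist x m}" if "j \<le> N" for j
      using that N mult_right_mono[of "real j" "real N" "dist x m"] by (auto simp: field_simps)
    have "dist (c i) (c (Suc i)) = \<bar>real i * (dist x m / N) - real (Suc i) * (dist x m / N)\<bar>"
      unfolding c_def using that by (intro geodesic_dist[OF geo] *) auto
    also have "\<dots> = dist x m / N"
      by (simp add: left_diff_distrib[symmetric] del: times_divide_eq_right)
    also have "\<dots> \<le> 8 * \<epsilon> / N"
      using assms N by (auto simp: shadow_def divide_right_mono)
    finally show ?thesis .
  qed
  have "link m (\<epsilon> / 2) (16 * \<epsilon>) (z i) (z (Suc i))" if "i < N" for i
  proof (rule link_near)
    have "dist v (z i) \<le> dist v x" unfolding z_def by (intro comb_dist_start_le) auto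
    then show "\<epsilon> \<le> dist (z i) m"
      using assms dist_triangle[of v m "z i"] by (auto simp: shadow_def)
    have "dist (z i) (z (Suc i)) \<le> \<kappa> * dist (c i) (c (Suc i)) + \<kappa>"
      unfolding z_def by (rule bounded)
    also have "\<dots> \<le> \<kappa> * (8 * \<epsilon> / N) + \<kappa>"
      using c[OF that] kappa_ge by (intro add_right_mono mult_left_mono) auto
    \<comment> \<open>This is what \<open>N_ge\<close> is calibrated for; the additive
      \<open>\<kappa>\<close> costs at most \<open>\<epsilon> / 8\<close> more.\<close>
    also have "\<kappa> * (8 * \<epsilon> / N) \<le> \<epsilon> / 4"
      using N N_ge eps_pos mult_right_mono[of "32 * \<kappa>" N \<epsilon>] by (auto simp: field_simps)
    also have "\<epsilon> / 4 + \<kappa> < \<epsilon> / 2" using eps_pos by auto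
    finally show "dist (z i) (z (Suc i)) < \<epsilon> / 2" by simp
  qed
  then have "reach N (z 0) (z N)" by (rule relpowp_chain)
  moreover have "z 0 = x"
    unfolding z_def c_def using geodesic_start[OF geo] geodesic_end[OF geo] by simp
  moreover have "z N = q v m (dist v x)"
    unfolding z_def c_def using geodesic_end[OF geo, of x m] N by simp
  ultimately show ?thesis by simp
qed

text \<open>Both points slide onto the combing line from \<open>v\<close> to \<open>m\<close>, using
  \<open>N\<close> links each; one link along that line, still at least \<open>\<epsilon>\<close>
  before \<open>m\<close>, connects the results.\<close>

lemma shadow_reach:
  assumes "x \<in> shadow v" "y \<in> shadow v"
  shows "reach (2 * N + 1) x y"
proof -
  have *: "dist x y \<le> 16 * \<epsilon>"
    using assms dist_triangle2[of x y m] by (auto simp: shadow_def)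
  have "link m (\<epsilon> / 2) (16 * \<epsilon>) (q v m (dist v x)) (q v m (dist v y))"
  proof (rule link_sub[OF geo])
    show "\<bar>dist v x - dist v y\<bar> \<le> 16 * \<epsilon>"
      using * abs_dist_diff_le[of x v y] by (auto simp: dist_commute)
    fix u assume "u \<in> {0..dist v m}" "u \<le> max (dist v x) (dist v y)"
    then show "\<epsilon> / 2 < dist (q v m u) m"
      using assms eps_pos geodesic_dist_end[OF geo, of u v m] by (auto simp: shadow_def)
  qed (use assms eps_pos in \<open>auto simp: shadow_def\<close>)
  then have "reach 1 (q v m (dist v x)) (q v m (dist v y))" by (simp add: eq_OO)
  then have "reach (N + (1 + N)) x y"
    using relpowp_trans shadow_reach_comb[OF assms(1)] reach_sym[OF shadow_reach_comb[OF assms(2)]]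
    by metis
  then show ?thesis by (simp add: mult_2)
qed

text \<open>A geodesic that avoids the \<open>\<epsilon>\<close>-ball but comes within \<open>2 * \<epsilon>\<close> of \<open>m\<close> meets the shadow
  of each of its endpoints, here just before and just after its close encounter with \<open>m\<close>.\<close>

lemma grazing_geodesic_shadows:
  assumes miss: "misses v u" and near: "dist (q v u t) m \<le> 2 * \<epsilon>"
  obtains z z' where "z \<in> shadow v" "z' \<in> shadow u" "reach 1 z z'"
proof -
  define \<tau> where "\<tau> = max 0 (min t (dist v u))"
  have \<tau>: "\<tau> \<in> {0..dist v u}" "dist (q v u \<tau>) m \<le> 2 * \<epsilon>"
    using near comb_clamp[of v u t] by (auto simp: \<tau>_def)
  \<comment> \<open>As \<open>\<tau> \<le> dist v m + 2 * \<epsilon>\<close>, retreating by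
    \<open>3 * \<epsilon>\<close> gains the required \<open>\<epsilon>\<close>. If the retreat is
    cut off at \<open>v\<close>, then \<open>v\<close> itself serves, being more than
    \<open>\<epsilon>\<close> from \<open>m\<close>. The same holds for \<open>b\<close> and
    \<open>u\<close>.\<close>
  define a where "a = max 0 (\<tau> - 3 * \<epsilon>)"
  define b where "b = min (dist v u) (\<tau> + 3 * \<epsilon>)"
  have ab: "a \<in> {0..dist v u}" "b \<in> {0..dist v u}" "\<bar>a - \<tau>\<bar> \<le> 3 * \<epsilon>" "\<bar>b - \<tau>\<bar> \<le> 3 * \<epsilon>"
    using \<tau> eps_pos by (auto simp: a_def b_def)
  have ends: "\<epsilon> < dist v m" "\<epsilon> < dist u m"
    using miss geodesic_start[OF geo, of v u] geodesic_end[OF geo, of v u] by metis+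
  have near': "dist (q v u s) m \<le> 8 * \<epsilon>" if "s \<in> {0..dist v u}" "\<bar>s - \<tau>\<bar> \<le> 3 * \<epsilon>" for s
    using geodesic_dist[OF geo, of s v u \<tau>] that \<tau> eps_pos dist_triangle[of "q v u s" m "q v u \<tau>"]
    by auto
  have "\<tau> \<le> dist v m + 2 * \<epsilon>"
    using geodesic_dist_start[OF geo \<tau>(1)] \<tau>(2) dist_triangle2[of v "q v u \<tau>" m] by auto
  then have 1: "q v u a \<in> shadow v"
    unfolding shadow_def using near'[of a] ab geodesic_dist_start[OF geo ab(1)] ends
    by (auto simp: a_def)
  have "dist v u - \<tau> \<le> dist u m + 2 * \<epsilon>"
    using geodesic_dist_end[OF geo \<tau>(1)] \<tau>(2) dist_triangle2[of "q v u \<tau>" u m] by auto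
  then have 2: "q v u b \<in> shadow u"
    unfolding shadow_def using near'[of b] ab geodesic_dist_end[OF geo ab(2)] ends
    by (auto simp: b_def dist_commute)
  have "link m (\<epsilon> / 2) (16 * \<epsilon>) (q v u a) (q v u b)"
  proof (rule link_sub[OF geo ab(1,2)])
    show "\<bar>a - b\<bar> \<le> 16 * \<epsilon>" using ab eps_pos by auto
    show "\<epsilon> / 2 < dist (q v u s) m" for s using miss eps_pos by (smt (verit) field_sum_of_halves)
  qed
  then show ?thesis using that[OF 1 2] by (simp add: eq_OO)
qed

text \<open>Points \<open>u\<close> on the combing line from \<open>m\<close> to \<open>w\<close> have their shadow inside that of \<open>w\<close>. As
  \<open>u\<close> runs along it from \<open>m\<close> to \<open>w\<close>, the line from \<open>v\<close> to \<open>u\<close> stops hitting the ball at some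
  moment, and at that moment it grazes the ball.\<close>

lemma misses_reach:
  assumes "misses v w" "x \<in> shadow v" "y \<in> shadow w"
  shows "reach (4 * N + 3) x y"
proof -
  let ?P = "\<lambda>s. \<not> misses v (q m w s)"
  \<comment> \<open>At parameter 0 the target is \<open>m\<close> itself, so the line from
    \<open>v\<close> ends in the ball.\<close>
  have "\<not> \<epsilon> < dist (q v (q m w 0) (dist v m)) m"
    using geodesic_start[OF geo, of m w] geodesic_end[OF geo, of v m] eps_pos by simp
  then have P0: "?P 0" by blast
  have P1: "\<not> ?P (dist m w)" using geodesic_end[OF geo, of m w] assms(1) by simp
  obtain s s' where s: "s \<in> {0..dist m w}" "s' \<in> {0..dist m w}" "\<bar>s - s'\<bar> \<le> 1"
    and bad: "?P s" and "\<not> ?P s'"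
    by (rule discrete_crossing[of ?P, OF P0 P1 zero_le_dist])
  then have good: "misses v (q m w s')" by blast
  define u where "u = q m w s'"
  obtain t where t: "dist (q v (q m w s) t) m \<le> \<epsilon>" using bad by (auto simp: not_less)
  \<comment> \<open>A shift of the target by at most 1 moves the line by at most
    \<open>2 * \<kappa>\<close>, so the line to \<open>u\<close> misses the ball but still grazes
    it.\<close>
  have "dist (q v (q m w s) t) (q v u t) \<le> \<kappa> * dist (q m w s) u + \<kappa>" by (rule bounded)
  also have "dist (q m w s) u = \<bar>s - s'\<bar>" unfolding u_def by (rule geodesic_dist[OF geo s(1,2)])
  also have "\<kappa> * \<bar>s - s'\<bar> + \<kappa> \<le> \<epsilon>"
    using mult_left_mono[OF s(3), of \<kappa>] kappa_ge eps_pos by linarith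
  finally have "dist (q v u t) m \<le> 2 * \<epsilon>"
    using t dist_triangle3[of "q v u t" m "q v (q m w s) t"] by auto
  then obtain z z' where z: "z \<in> shadow v" "z' \<in> shadow u" "reach 1 z z'"
    using grazing_geodesic_shadows good unfolding u_def by blast
  have "dist w m = dist u m + dist w u"
    using geodesic_dist_start[OF geo s(2)] geodesic_dist_end[OF geo s(2)]
    by (auto simp: u_def dist_commute)
  then have "z' \<in> shadow w"
    using z(2) dist_triangle[of w z' u] by (auto simp: shadow_def)
  then have "reach ((2 * N + 1) + (1 + (2 * N + 1))) x y"
    using shadow_reach assms z relpowp_trans by metis
  moreover have "(2 * N + 1) + (1 + (2 * N + 1)) = 4 * N + 3" by simp
  ultimately show ?thesis by metis
qed

lemma shadow_pointE:
  assumes "c \<le> 8 * \<epsilon>" "0 \<le> c" "c \<le> dist v m"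
  obtains z where "dist z m = c" "dist v z = dist v m - c"
proof
  have *: "dist v m - c \<in> {0..dist v m}" using assms by auto
  show "dist (q v m (dist v m - c)) m = c" using geodesic_dist_end[OF geo *] by simp
  show "dist v (q v m (dist v m - c)) = dist v m - c" using geodesic_dist_start[OF geo *] by simp
qed

lemma shadow_nonempty:
  assumes "\<epsilon> \<le> dist v m"
  obtains z where "z \<in> shadow v"
proof -
  obtain z where "dist z m = \<epsilon>" "dist v z = dist v m - \<epsilon>"
    using shadow_pointE[of \<epsilon> v] eps_pos assms by auto
  then have "z \<in> shadow v" using eps_pos by (simp add: shadow_def)
  then show ?thesis by (rule that)
qed

text \<open>A line passing within \<open>\<epsilon>\<close> of \<open>m\<close> is almost a detour
  through \<open>m\<close>; each half loses at most \<open>\<epsilon>\<close>.\<close>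

lemma hits_dist:
  assumes "\<not> misses v w"
  shows "dist v m + dist w m - 2 * \<epsilon> \<le> dist v w"
proof -
  obtain t where t: "dist (q v w t) m \<le> \<epsilon>" using assms by (auto simp: not_less)
  define \<tau> where "\<tau> = max 0 (min t (dist v w))"
  have \<tau>: "\<tau> \<in> {0..dist v w}" "dist (q v w \<tau>) m \<le> \<epsilon>"
    using t comb_clamp[of v w t] by (auto simp: \<tau>_def)
  then show ?thesis
    using geodesic_dist_start[OF geo \<tau>(1)] geodesic_dist_end[OF geo \<tau>(1)]
      dist_triangle[of v m "q v w \<tau>"] dist_triangle[of w m "q v w \<tau>"] dist_commute[of w "q v w \<tau>"]
    by auto
qed

text \<open>Let \<open>c'\<close> be where, along the geodesic, the combing line from \<open>a\<close> starts to hit the ball. The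
  combing line from \<open>c'\<close> to \<open>b\<close> misses the ball: otherwise the detour through \<open>c'\<close> would be
  longer than \<open>dist a b\<close>.\<close>

lemma geodesic_reach:
  assumes g: "geodesic_from_to a b g" and far: "\<And>t. t \<in> {0..dist a b} \<Longrightarrow> 4 * \<epsilon> \<le> dist (g t) m"
    and x: "x \<in> shadow a" and y: "y \<in> shadow b"
  shows "reach (8 * N + 6) x y"
proof -
  have ends: "4 * \<epsilon> \<le> dist a m" "4 * \<epsilon> \<le> dist b m"
    using far[of 0] far[of "dist a b"] geodesic_start[OF g] geodesic_end[OF g] by auto
  have const: "misses c c" if "4 * \<epsilon> \<le> dist c m" for c
    using comb_clamp[of c c] geodesic_start[OF geo, of c c] that eps_pos by auto
  have "\<exists>z c c'. misses a c \<and> z \<in> shadow c \<and> z \<in> shadow c' \<and> misses c' b"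
  proof (cases "misses a b")
    case True
    \<comment> \<open>Here \<open>c = c' = b\<close> and \<open>z = y\<close>.\<close>
    then show ?thesis using y const[OF ends(2)] by blast
  next
    case False
    let ?P = "\<lambda>s. misses a (g s)"
    have P0: "?P 0" using const ends geodesic_start[OF g] by simp
    have P1: "\<not> ?P (dist a b)" using geodesic_end[OF g] False by simp
    obtain s s' where s: "s \<in> {0..dist a b}" "s' \<in> {0..dist a b}" "\<bar>s - s'\<bar> \<le> 1"
      "?P s" "\<not> ?P s'"
      by (rule discrete_crossing[of ?P, OF P0 P1 zero_le_dist])
    have c': "misses (g s') b"
    proof (rule ccontr)
      assume "\<not> misses (g s') b"
      \<comment> \<open>Adding the two detour bounds along \<open>g\<close> gives
        \<open>2 * dist (g s') m \<le> 4 * \<epsilon>\<close>, contradicting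
        \<open>far\<close>.\<close>
      then show False
        using hits_dist[OF s(5)] hits_dist[of "g s'" b] far[OF s(2)] eps_pos
          geodesic_dist_start[OF g s(2)] geodesic_dist_end[OF g s(2)] dist_triangle2[of a b m]
        by auto
    qed
    \<comment> \<open>Depth \<open>2 * \<epsilon>\<close> instead of \<open>\<epsilon>\<close>
      leaves slack for replacing \<open>g s\<close> by \<open>g s'\<close>, which costs at most
      2.\<close>
    obtain z where z: "dist z m = 2 * \<epsilon>" "dist (g s) z = dist (g s) m - 2 * \<epsilon>"
      using shadow_pointE[of "2 * \<epsilon>" "g s"] far[OF s(1)] eps_pos by auto
    have "dist (g s') (g s) \<le> 1" using geodesic_dist[OF g s(2,1)] s(3) by auto
    then have "z \<in> shadow (g s')"
      using z eps_pos dist_triangle[of "g s'" z "g s"] dist_triangle[of "g s" m "g s'"]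
      by (auto simp: shadow_def dist_commute)
    moreover have "z \<in> shadow (g s)" using z eps_pos by (auto simp: shadow_def)
    ultimately show ?thesis using s(4) c' by blast
  qed
  then have "reach ((4 * N + 3) + (4 * N + 3)) x y"
    using misses_reach x y relpowp_trans by metis
  moreover have "(4 * N + 3) + (4 * N + 3) = 8 * N + 6" by simp
  ultimately show ?thesis by metis
qed

lemma geodesic_segment_reach:
  assumes "g \<in> geodesic_segments" and far: "\<And>z. z \<in> path_image g \<Longrightarrow> 4 * \<epsilon> \<le> dist z m"
    and "x \<in> shadow (pathstart g)" "y \<in> shadow (pathfinish g)"
  shows "reach (8 * N + 6) x y"
proof -
  obtain a b h where h: "geodesic_from_to a b h" "\<forall>s\<in>{0..1}. g s = h (dist a b * s)"
    using assms(1) unfolding geodesic_segments_def by blast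
  have "4 * \<epsilon> \<le> dist (h t) m" if "t \<in> {0..dist a b}" for t
  proof -
    \<comment> \<open>If \<open>a = b\<close>, then \<open>t = 0\<close> and division by zero yields
      0.\<close>
    have "t / dist a b \<in> {0..1}" "dist a b * (t / dist a b) = t"
      using that by (cases "a = b"; auto)+
    then have "h t \<in> path_image g" using h(2) unfolding path_image_def by (metis image_eqI)
    then show ?thesis by (rule far)
  qed
  moreover have "pathstart g = a" "pathfinish g = b"
    using h geodesic_start[OF h(1)] geodesic_end[OF h(1)] by (auto simp: pathstart_def pathfinish_def)
  ultimately show ?thesis using geodesic_reach[OF h(1)] assms(3,4) by blast
qed

text \<open>Inner vertices may be far from \<open>m\<close>, so each is replaced by a point of its
  shadow. The bound \<open>1 \<le> j\<close> is kept because a polygonal line has at least one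
  segment.\<close>

lemma polygonal_line_reach:
  assumes "polygonal_line geodesic_segments n \<alpha>" "\<And>z. z \<in> path_image \<alpha> \<Longrightarrow> 4 * \<epsilon> \<le> dist z m"
    "x \<in> shadow (pathstart \<alpha>)" "y \<in> shadow (pathfinish \<alpha>)"
  shows "\<exists>j\<in>{1..(8 * N + 6) * n}. reach j x y"
  using assms
proof (induction arbitrary: y rule: polygonal_line.induct)
  case (single g n)
  have "8 * N + 6 \<in> {1..(8 * N + 6) * n}" using single(2) by (cases n) auto
  then show ?case using geodesic_segment_reach[OF single(1)] single by blast
next
  case (join n p g)
  have im: "path_image (p +++ g) = path_image p \<union> path_image g"
    using join.hyps by (simp add: path_image_join)
  have "pathfinish p \<in> path_image p" by (rule pathfinish_in_path_image)
  then have "4 * \<epsilon> \<le> dist (pathfinish p) m" using join.prems(1) im by blast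
  then obtain z where z: "z \<in> shadow (pathfinish p)"
    using shadow_nonempty[of "pathfinish p"] eps_pos by auto
  obtain j where j: "j \<in> {1..(8 * N + 6) * n}" "reach j x z"
    using join.IH[of z] join.prems im z by auto
  have "reach (8 * N + 6) z y"
    using geodesic_segment_reach[OF join.hyps(2), of z y] join.prems join.hyps im z by auto
  with j have "reach (j + (8 * N + 6)) x y" by (metis relpowp_trans)
  moreover have "j + (8 * N + 6) \<in> {1..(8 * N + 6) * Suc n}" using j(1) by auto
  ultimately show ?case by blast
qed

end

section \<open>Paths and lengths\<close>

text \<open>A control function \<open>\<phi>\<close> certifies a bound on the length and is easily concatenated.\<close>

definition length_le :: "(real \<Rightarrow> 'a::metric_space) \<Rightarrow> real \<Rightarrow> bool" where
  "length_le p l \<longleftrightarrow> (\<exists>\<phi>::real \<Rightarrow> real. \<phi> 0 = 0 \<and> \<phi> 1 \<le> l \<and>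
     (\<forall>s t. 0 \<le> s \<longrightarrow> s \<le> t \<longrightarrow> t \<le> 1 \<longrightarrow> dist (p s) (p t) \<le> \<phi> t - \<phi> s))"

lemma path_length_le_of_length_le:
  assumes "length_le p l"
  shows "path_length p \<le> ennreal l"
proof -
  obtain \<phi> :: "real \<Rightarrow> real" where \<phi>: "\<phi> 0 = 0" "\<phi> 1 \<le> l"
    and d: "\<And>s t. 0 \<le> s \<Longrightarrow> s \<le> t \<Longrightarrow> t \<le> 1 \<Longrightarrow> dist (p s) (p t) \<le> \<phi> t - \<phi> s"
    using assms unfolding length_le_def by metis
  have mono: "\<phi> s \<le> \<phi> t" if "0 \<le> s" "s \<le> t" "t \<le> 1" for s t
    using d[OF that] zero_le_dist[of "p s" "p t"] by linarith
  have "(\<Sum>i<length ts - 1. ennreal (dist (p (ts ! i)) (p (ts ! Suc i)))) \<le> ennreal l"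
    if ts: "sorted ts" "set ts \<subseteq> {0..1}" for ts
  proof -
    have in01: "0 \<le> ts ! i" "ts ! i \<le> 1" if "i < length ts" for i
      using ts(2) nth_mem[OF that] by (auto dest!: subsetD)
    have "(\<Sum>i<length ts - 1. dist (p (ts ! i)) (p (ts ! Suc i)))
        \<le> (\<Sum>i<length ts - 1. \<phi> (ts ! Suc i) - \<phi> (ts ! i))"
    proof (rule sum_mono)
      fix i assume "i \<in> {..<length ts - 1}"
      then have "Suc i < length ts" by auto
      then show "dist (p (ts ! i)) (p (ts ! Suc i)) \<le> \<phi> (ts ! Suc i) - \<phi> (ts ! i)"
        using in01[of i] in01[of "Suc i"] sorted_nth_mono[OF ts(1), of i "Suc i"] by (intro d) auto
    qed
    also have "\<dots> = \<phi> (ts ! (length ts - 1)) - \<phi> (ts ! 0)" by (rule sum_lessThan_telescope)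
    also have "\<dots> \<le> l"
    \<comment> \<open>For the empty list truncated subtraction makes both indices 0, so only
      \<open>0 \<le> l\<close> remains.\<close>
    proof (cases "ts = []")
      case True
      then show ?thesis using mono[of 0 1] \<phi> by simp
    next
      case False
      then have "0 \<le> ts ! 0" "ts ! 0 \<le> 1" "0 \<le> ts ! (length ts - 1)" "ts ! (length ts - 1) \<le> 1"
        using in01 by auto
      then show ?thesis using mono[of 0 "ts ! 0"] mono[of "ts ! (length ts - 1)" 1] \<phi> by auto
    qed
    finally show ?thesis by (simp add: sum_ennreal ennreal_leI)
  qed
  then show ?thesis unfolding path_length_def by (intro SUP_least) auto
qed

lemma length_le_join:
  assumes "length_le p k" "length_le g l" "pathfinish p = pathstart g"
  shows "length_le (p +++ g) (k + l)"
proof -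
  obtain \<phi> :: "real \<Rightarrow> real" where \<phi>: "\<phi> 0 = 0" "\<phi> 1 \<le> k"
    and dp: "\<And>s t. 0 \<le> s \<Longrightarrow> s \<le> t \<Longrightarrow> t \<le> 1 \<Longrightarrow> dist (p s) (p t) \<le> \<phi> t - \<phi> s"
    using assms(1) unfolding length_le_def by metis
  obtain \<psi> :: "real \<Rightarrow> real" where \<psi>: "\<psi> 0 = 0" "\<psi> 1 \<le> l"
    and dg: "\<And>s t. 0 \<le> s \<Longrightarrow> s \<le> t \<Longrightarrow> t \<le> 1 \<Longrightarrow> dist (g s) (g t) \<le> \<psi> t - \<psi> s"
    using assms(2) unfolding length_le_def by metis
  define \<omega> where "\<omega> t = (if t \<le> 1 / 2 then \<phi> (2 * t) else \<phi> 1 + \<psi> (2 * t - 1))" for t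
  have "dist ((p +++ g) s) ((p +++ g) t) \<le> \<omega> t - \<omega> s" if "0 \<le> s" "s \<le> t" "t \<le> 1" for s t
  proof -
    consider "t \<le> 1 / 2" | "s \<le> 1 / 2" "1 / 2 < t" | "1 / 2 < s" using that by linarith
    then show ?thesis
    proof cases
      case 1
      then show ?thesis using that dp[of "2 * s" "2 * t"] by (auto simp: joinpaths_def \<omega>_def)
    next
      case 2
      have "dist (p (2 * s)) (g (2 * t - 1)) \<le> dist (p (2 * s)) (p 1) + dist (g 0) (g (2 * t - 1))"
        using assms(3) dist_triangle[of "p (2 * s)" "g (2 * t - 1)" "p 1"]
        by (simp add: pathfinish_def pathstart_def)
      then show ?thesis
        using 2 that dp[of "2 * s" 1] dg[of 0 "2 * t - 1"] \<psi> by (auto simp: joinpaths_def \<omega>_def)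
    next
      case 3
      then show ?thesis
        using that dg[of "2 * s - 1" "2 * t - 1"] by (auto simp: joinpaths_def \<omega>_def)
    qed
  qed
  moreover have "\<omega> 0 = 0" "\<omega> 1 \<le> k + l" using \<phi> \<psi> by (auto simp: \<omega>_def)
  ultimately show ?thesis unfolding length_le_def by blast
qed

section \<open>Geodesic segments as a path system\<close>

lemma geodesic_segment_dist:
  assumes "geodesic_from_to x y h" "\<forall>s\<in>{0..1}. g s = h (dist x y * s)" "s \<in> {0..1}" "t \<in> {0..1}"
  shows "dist (g s) (g t) = dist x y * \<bar>s - t\<bar>"
proof -
  have "dist (h (dist x y * s)) (h (dist x y * t)) = \<bar>dist x y * s - dist x y * t\<bar>"
    using assms(3,4) by (intro geodesic_dist[OF assms(1)]) (auto simp: mult_left_le)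
  then show ?thesis using assms by (simp add: right_diff_distrib[symmetric] abs_mult)
qed

lemma geodesic_segment_ends:
  assumes "geodesic_from_to x y h" "\<forall>s\<in>{0..1}. g s = h (dist x y * s)"
  shows "pathstart g = x" "pathfinish g = y"
  using assms geodesic_start[OF assms(1)] geodesic_end[OF assms(1)]
  by (auto simp: pathstart_def pathfinish_def)

lemma geodesic_segment_length_le:
  assumes "g \<in> geodesic_segments"
  shows "length_le g (dist (pathstart g) (pathfinish g))"
proof -
  obtain x y h where h: "geodesic_from_to x y h" "\<forall>s\<in>{0..1}. g s = h (dist x y * s)"
    using assms unfolding geodesic_segments_def by blast
  show ?thesis
    unfolding length_le_def geodesic_segment_ends[OF h]
    by (intro exI[of _ "\<lambda>s. dist x y * s"])
      (auto simp: geodesic_segment_dist[OF h] right_diff_distrib[symmetric])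
qed

lemma geodesic_segment_path:
  assumes "g \<in> geodesic_segments"
  shows "path g"
proof -
  obtain x y h where h: "geodesic_from_to x y h" "\<forall>s\<in>{0..1}. g s = h (dist x y * s)"
    using assms unfolding geodesic_segments_def by blast
  have "(dist x y)-lipschitz_on {0..1} g"
    by (rule lipschitz_onI) (auto simp: geodesic_segment_dist[OF h] dist_real_def)
  then show ?thesis unfolding path_def by (rule lipschitz_on_continuous_on)
qed

lemma geodesic_segment_subpath:
  assumes "g \<in> geodesic_segments" "0 \<le> u" "u \<le> v" "v \<le> 1"
  shows "(\<lambda>s. g ((v - u) * s + u)) \<in> geodesic_segments"
proof -
  obtain x y h where h: "geodesic_from_to x y h" "\<forall>s\<in>{0..1}. g s = h (dist x y * s)"
    using assms unfolding geodesic_segments_def by blast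
  let ?u = "dist x y * u" and ?v = "dist x y * v"
  have uv: "0 \<le> ?u" "?u \<le> ?v" "?v \<le> dist x y"
    using assms by (auto simp: mult_left_mono mult_left_le)
  have d: "dist (h ?u) (h ?v) = dist x y * (v - u)"
    using geodesic_dist[OF h(1), of ?u ?v] uv by (auto simp: right_diff_distrib)
  have "g ((v - u) * s + u) = h (?u + dist (h ?u) (h ?v) * s)" if "s \<in> {0..1}" for s
  proof -
    have "(v - u) * s \<le> v - u" "0 \<le> (v - u) * s" using that assms by (auto simp: mult_left_le)
    then have "(v - u) * s + u \<in> {0..1}" using assms by auto
    then show ?thesis using h(2) unfolding d by (simp add: algebra_simps)
  qed
  then show ?thesis using geodesic_sub[OF h(1) uv] unfolding geodesic_segments_def by blast
qed

lemma geodesic_segmentI: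
  assumes "geodesic_from_to x y h"
  shows "(\<lambda>s. h (dist x y * s)) \<in> geodesic_segments"
  using assms unfolding geodesic_segments_def by blast

lemma geodesic_segments_path_system:
  assumes "geodesic_metric_space TYPE('a::metric_space)"
  shows "path_system (geodesic_segments :: (real \<Rightarrow> 'a) set)"
  unfolding path_system_def
proof (intro conjI)
  show "\<exists>\<mu>\<ge>1. \<exists>c\<ge>0. \<forall>g\<in>geodesic_segments :: (real \<Rightarrow> 'a) set.
      path_length g \<le> ennreal (\<mu> * dist (pathstart g) (pathfinish g) + c)"
    by (rule exI[of _ 1], simp, rule exI[of _ 0])
      (auto intro!: path_length_le_of_length_le geodesic_segment_length_le)
  show "\<forall>x y. \<exists>g\<in>geodesic_segments. pathstart g = (x :: 'a) \<and> pathfinish g = y"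
  proof (intro allI)
    fix x y :: 'a
    obtain h where "geodesic_from_to x y h" using assms unfolding geodesic_metric_space_def by blast
    then show "\<exists>g\<in>geodesic_segments. pathstart g = x \<and> pathfinish g = y"
      using geodesic_segmentI geodesic_segment_ends[of x y h "\<lambda>s. h (dist x y * s)"] by blast
  qed
qed (auto intro: geodesic_segment_path geodesic_segment_subpath)

section \<open>From chains of links to polygonal lines\<close>

lemma link_geodesic_segment:
  assumes "link m r l x y"
  obtains g where "g \<in> geodesic_segments" "pathstart g = x" "pathfinish g = y" "length_le g l"
    "path_image g \<inter> cball m r = {}"
proof -
  obtain h where h: "geodesic_from_to x y h" "\<forall>t\<in>{0..dist x y}. r < dist (h t) m"
    and l: "dist x y \<le> l"
    using assms unfolding link_def by blast
  let ?g = "\<lambda>s. h (dist x y * s)"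
  have g: "?g \<in> geodesic_segments" "pathstart ?g = x" "pathfinish ?g = y"
    using geodesic_segmentI[OF h(1)] geodesic_segment_ends[OF h(1), of ?g] by auto
  moreover have "length_le ?g l"
    using geodesic_segment_length_le[OF g(1)] l g unfolding length_le_def by force
  moreover have "path_image ?g \<inter> cball m r = {}"
  proof -
    have "r < dist (?g s) m" if "s \<in> {0..1}" for s
      using that by (intro h(2)[rule_format]) (auto simp: mult_left_le)
    then show ?thesis by (force simp: path_image_def dist_commute)
  qed
  ultimately show ?thesis by (rule that)
qed

lemma link_chain_polygonal_line:
  assumes "(link m r l ^^ j) x y" "1 \<le> j" "j \<le> n"
  shows "\<exists>p. polygonal_line geodesic_segments n p \<and> pathstart p = x \<and> pathfinish p = y \<and>
    length_le p (real j * l) \<and> path_image p \<inter> cball m r = {}"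
  using assms(2,1,3)
proof (induction j arbitrary: y n rule: dec_induct)
  case base
  then have "link m r l x y" by (simp add: eq_OO)
  then obtain g where "g \<in> geodesic_segments" "pathstart g = x" "pathfinish g = y" "length_le g l"
    "path_image g \<inter> cball m r = {}"
    by (rule link_geodesic_segment)
  then show ?case using base by (intro exI[of _ g]) (auto intro: polygonal_line.single)
next
  case (step j)
  then obtain z n' where z: "(link m r l ^^ j) x z" "link m r l z y" and n: "n = Suc n'" "j \<le> n'"
    by (cases n) auto
  obtain p where p: "polygonal_line geodesic_segments n' p" "pathstart p = x" "pathfinish p = z"
    "length_le p (real j * l)" "path_image p \<inter> cball m r = {}"
    using step.IH[OF z(1) n(2)] by blast
  obtain g where g: "g \<in> geodesic_segments" "pathstart g = z" "pathfinish g = y" "length_le g l"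
    "path_image g \<inter> cball m r = {}"
    using link_geodesic_segment[OF z(2)] by blast
  have "polygonal_line geodesic_segments n (p +++ g)"
    unfolding n using p g by (intro polygonal_line.join) auto
  moreover have "length_le (p +++ g) (real (Suc j) * l)"
    using length_le_join[OF p(4) g(4)] p g by (simp add: algebra_simps)
  moreover have "path_image (p +++ g) \<inter> cball m r = {}"
    using p g by (subst path_image_join) auto
  ultimately show ?case using p g by (intro exI[of _ "p +++ g"]) auto
qed

section \<open>Navigability\<close>

lemma geodesic_segments_navigable:
  fixes q :: "'a::metric_space \<Rightarrow> 'a \<Rightarrow> real \<Rightarrow> 'a"
  assumes comb: "geodesic_combing q" and "bounded_combing q"
  shows "navigable (geodesic_segments :: (real \<Rightarrow> 'a) set)"
proof -
  obtain \<kappa>\<^sub>0 where \<kappa>\<^sub>0: "\<kappa>\<^sub>0 \<ge> 0" "\<And>t x y z. dist (q x y t) (q x z t) \<le> \<kappa>\<^sub>0 * dist y z + \<kappa>\<^sub>0"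
    using assms(2) unfolding bounded_combing_def by blast
  define \<kappa> where "\<kappa> = \<kappa>\<^sub>0 + 1"
  have \<kappa>: "1 \<le> \<kappa>" "dist (q x y t) (q x z t) \<le> \<kappa> * dist y z + \<kappa>" for x y z t
    using \<kappa>\<^sub>0(1) order_trans[OF \<kappa>\<^sub>0(2)[of x y t z], of "\<kappa> * dist y z + \<kappa>"]
    by (auto simp: \<kappa>_def distrib_right add_increasing2)
  define N where "N = nat \<lceil>32 * \<kappa>\<rceil>"
  have N: "32 * \<kappa> \<le> real N" unfolding N_def by (rule real_nat_ceiling_ge)
  define k where "k = 8 * N + 6"
  \<comment> \<open>At most \<open>k * n\<close> links of length \<open>16 * (R / 4)\<close> have
    total length at most \<open>4 * k * n * R\<close>. Moreover
    \<open>32 * \<kappa> \<le> C \<le> R\<close> yields \<open>eps_ge\<close> for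
    \<open>\<epsilon> = R / 4\<close>, and \<open>8 \<le> C\<close> puts the ball of radius
    \<open>R / C\<close> inside the avoided one of radius \<open>R / 8\<close>.\<close>
  define C where "C = 4 * real k"
  have C: "32 * \<kappa> \<le> C" "8 \<le> C" using N \<kappa>(1) by (auto simp: C_def k_def)
  show ?thesis
    unfolding navigable_def
  proof (intro exI[of _ C] exI[of _ k] conjI allI impI)
    show "1 \<le> C" "1 \<le> k" using C by (auto simp: k_def)
    fix R m n and \<alpha> :: "real \<Rightarrow> 'a"
    assume R: "C \<le> R"
    assume A: "polygonal_line geodesic_segments n \<alpha> \<and> R \<le> infdist m (path_image \<alpha>) \<and>
      dist (pathstart \<alpha>) m \<le> 2 * R \<and> dist (pathfinish \<alpha>) m \<le> 2 * R"
    interpret combed_ball q \<kappa> m "R / 4" N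
      using comb \<kappa> N C R by unfold_locales auto
    have far: "4 * (R / 4) \<le> dist z m" if "z \<in> path_image \<alpha>" for z
      using A infdist_le[OF that, of m] by (auto simp: dist_commute)
    have "pathstart \<alpha> \<in> shadow (pathstart \<alpha>)" "pathfinish \<alpha> \<in> shadow (pathfinish \<alpha>)"
      using A far[OF pathstart_in_path_image] far[OF pathfinish_in_path_image] R C
      by (auto simp: shadow_def)
    then obtain j where j: "j \<in> {1..k * n}" "reach j (pathstart \<alpha>) (pathfinish \<alpha>)"
      using polygonal_line_reach[OF _ far] A unfolding k_def by blast
    then obtain p where p: "polygonal_line geodesic_segments (k * n) p"
      "pathstart p = pathstart \<alpha>" "pathfinish p = pathfinish \<alpha>"
      "length_le p (real j * (16 * (R / 4)))" "path_image p \<inter> cball m (R / 4 / 2) = {}"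
      using link_chain_polygonal_line[OF j(2), of "k * n"] by auto
    have "real j \<le> real k * real n" using j(1) of_nat_mono[of j "k * n"] by simp
    then have "real j * (16 * (R / 4)) \<le> C * real n * R"
      using R C mult_right_mono[of "real j" "real k * real n" "4 * R"]
      by (simp add: C_def algebra_simps)
    then have len: "path_length p \<le> ennreal (C * real n * R)"
      using path_length_le_of_length_le[OF p(4)] by (meson ennreal_leI order_trans)
    have "R / C \<le> R / 4 / 2" using R C divide_left_mono[of 8 C R] by simp
    then have "path_image p \<inter> cball m (R / C) = {}"
      using p(5) subset_cball[of "R / C" "R / 4 / 2" m] by blast
    then show "\<exists>p. polygonal_line geodesic_segments (k * n) p \<and> pathstart p = pathstart \<alpha> \<and>
        pathfinish p = pathfinish \<alpha> \<and> path_length p \<le> ennreal (C * real n * R) \<and>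
        path_image p \<inter> cball m (R / C) = {}"
      using p len by blast
  qed
qed

theorem proposition1p12:
  fixes q :: "'a::metric_space \<Rightarrow> 'a \<Rightarrow> real \<Rightarrow> 'a"
  assumes "geodesic_metric_space TYPE('a)"
    and "geodesic_combing q"
    and "bounded_combing q"
  shows "path_system (geodesic_segments :: (real \<Rightarrow> 'a) set)
       \<and> navigable (geodesic_segments :: (real \<Rightarrow> 'a) set)"
  using assms geodesic_segments_path_system geodesic_segments_navigable by blast

end
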